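(* Let $X(\tau)$ be the standard Wiener process on $\mathbb{R}$ with $X(0)=0$, and for $a>0$, $b>0$, $t>0$ let $$p_2(t,-b,a)=P\bigl(-b<X(\tau)<a\ \text{ for all } 0\le\tau\le t\bigr).$$ Then for fixed $a>0$ and $t>0$, as $b\to\infty$, $$p_2(t,-b,a)=1-\sqrt{\frac2\pi}\int_{a/\sqrt t}^{\infty}e^{-u^2/2}\,du-\sqrt{\frac2\pi}\int_{b/\sqrt t}^{(b+2a)/\sqrt t}e^{-u^2/2}\,du\,[1+o(1)].$$
   Context: The Wiener process here is the one with generator $\frac12\frac{d^2}{dx^2}$. The factor $[1+o(1)]$ multiplies only the last term. *)

theory Defs
  imports "HOL-Probability.Probability"
begin

text \<open>
  The process is indexed by \<open>{0..}\<close>; its values at negative times are irrelevant.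
  The increment over \<open>[s, t]\<close> has variance \<open>t - s\<close>, which is the normalisation
  with generator \<open>(1/2) d^2/dx^2\<close>; note that \<^const>\<open>normal_density\<close> takes the standard
  deviation as its second argument. All sample paths are continuous (not just almost all),
  so that events quantifying over all times in an interval are measurable.
\<close>

locale standard_wiener_process = prob_space M for M :: "'a measure" +
  fixes X :: "real \<Rightarrow> 'a \<Rightarrow> real"
  assumes random_variable_at: "\<And>t. 0 \<le> t \<Longrightarrow> random_variable borel (X t)"
    and start_at_zero: "\<And>\<omega>. \<omega> \<in> space M \<Longrightarrow> X 0 \<omega> = 0"
    and continuous_paths: "\<And>\<omega>. \<omega> \<in> space M \<Longrightarrow> continuous_on {0..} (\<lambda>t. X t \<omega>)"
    and gaussian_increments: "\<And>s t. 0 \<le> s \<Longrightarrow> s < t \<Longrightarrow>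
          distributed M lborel (\<lambda>\<omega>. X t \<omega> - X s \<omega>)
            (\<lambda>x. ennreal (normal_density 0 (sqrt (t - s)) x))"
    and independent_increments: "\<And>(n::nat) (s :: nat \<Rightarrow> real).
          0 \<le> s 0 \<Longrightarrow> strict_mono_on {..n} s \<Longrightarrow>
          indep_vars (\<lambda>_. borel) (\<lambda>i \<omega>. X (s (Suc i)) \<omega> - X (s i) \<omega>) {..<n}"

definition p2 :: "'a measure \<Rightarrow> (real \<Rightarrow> 'a \<Rightarrow> real) \<Rightarrow> real \<Rightarrow> real \<Rightarrow> real \<Rightarrow> real" where
  "p2 M X t l r = measure M {\<omega> \<in> space M. \<forall>\<tau>\<in>{0..t}. l < X \<tau> \<omega> \<and> X \<tau> \<omega> < r}"

end

theory Submission
  imports Defs "HOL-Real_Asymp.Real_Asymp"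
begin

text \<open>
  The reflection principle, in a form that needs no stopping times: let \<open>f\<close> be a step function
  with \<open>f = 1\<close> on \<open>(l, r)\<close>. If \<open>f (x + y) + f (x - y) \<ge> 0\<close> for all \<open>y\<close> whenever \<open>x\<close> is just
  outside \<open>(l, r)\<close>, then by the symmetry of the remaining increment the paths that have left
  \<open>(l, r)\<close> contribute a nonnegative amount to \<open>E (f (X t))\<close>, so this expectation bounds the
  probability of staying inside from above; the opposite sign gives a lower bound. The exit is
  observed on the grid \<open>t j / N\<close>, and the overshoot of the boundary is at most \<open>\<delta>\<close> up to an event
  whose probability tends to 0 as \<open>N \<rightarrow> \<infinity>\<close>.

  Finitely many steps of the method of images give suitable functions, with small shifts by
  \<open>\<delta>\<close> that absorb the overshoot. The upper and the lower bound differ by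
  \<open>2 P (X t \<ge> 2 b + a)\<close>, which is of order \<open>exp (- (2 b + a)^2 / (2 t))\<close> and therefore
  negligible against \<open>exp (- (b + 2 a)^2 / (2 t))\<close>.
\<close>

section \<open>Vanishing events, grid points and symmetric independent increments\<close>

text \<open>Dominated convergence for the indicators, with majorant 1. It turns pathwise statements
  about sufficiently fine grids into limits of probabilities.\<close>

lemma (in finite_measure) measure_tendsto_0_if_eventually_notin:
  assumes "\<And>n. F n \<in> sets M"
    and "\<And>\<omega>. \<omega> \<in> space M \<Longrightarrow> eventually (\<lambda>n. \<omega> \<notin> F n) sequentially"
  shows "(\<lambda>n. measure M (F n)) \<longlonglongrightarrow> 0"
proof -
  have "(\<lambda>n. \<integral>\<omega>. indicat_real (F n) \<omega> \<partial>M) \<longlonglongrightarrow> (\<integral>\<omega>. 0 \<partial>M)"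
  proof (rule integral_dominated_convergence[where w = "\<lambda>_. 1"])
    show "AE \<omega> in M. (\<lambda>n. indicat_real (F n) \<omega>) \<longlonglongrightarrow> 0"
    proof (rule AE_I2)
      fix \<omega> assume "\<omega> \<in> space M"
      then have "eventually (\<lambda>n. indicat_real (F n) \<omega> = 0) sequentially"
        using assms(2) by (auto simp: indicator_def)
      then show "(\<lambda>n. indicat_real (F n) \<omega>) \<longlonglongrightarrow> 0"
        by (rule tendsto_eventually)
    qed
  qed (use assms(1) in \<open>auto simp: indicator_def\<close>)
  then show ?thesis
    using assms(1) by simp
qed

lemma grid_point_mem:
  assumes "0 \<le> t" "j \<le> N"
  shows "t * real j / real N \<in> {0..t}"
proof (cases "N = 0")
  case False
  have "t * real j \<le> t * real N"
    using assms by (intro mult_left_mono) auto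
  then show ?thesis
    using False assms by (simp add: divide_le_eq)
qed (use assms in auto)

text \<open>
  \<open>Y\<close> is wrapped as a one-point family because \<^const>\<open>prob_space.indep_var\<close> requires both
  random variables to have values in the same type.
\<close>

lemma (in prob_space) expectation_symmetric_nonneg:
  fixes Y :: "'a \<Rightarrow> real" and g :: "('i \<Rightarrow> real) \<Rightarrow> real" and f :: "real \<Rightarrow> real"
  assumes indep: "indep_var N V (PiM {m} (\<lambda>_. borel)) (\<lambda>\<omega>. \<lambda>i\<in>{m}. Y \<omega>)"
    and Y[measurable]: "Y \<in> borel_measurable M"
    and sym: "distr M borel (\<lambda>\<omega>. - Y \<omega>) = distr M borel Y"
    and S[measurable]: "S \<in> sets N"
    and g[measurable]: "g \<in> borel_measurable N"
    and f[measurable]: "f \<in> borel_measurable borel"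
    and bound: "\<And>x. \<bar>f x\<bar> \<le> 1"
    and pair: "\<And>v y. v \<in> S \<Longrightarrow> 0 \<le> f (g v + y) + f (g v - y)"
  shows "0 \<le> expectation (\<lambda>\<omega>. indicator S (V \<omega>) * f (g (V \<omega>) + Y \<omega>))"
proof -
  let ?P = "PiM {m} (\<lambda>_. borel :: real measure)" and ?e = "\<lambda>y. \<lambda>i\<in>{m}. y :: real"
  have V[measurable]: "V \<in> measurable M N"
    using indep_var_rv1[OF indep] by auto
  have "indep_var N (id \<circ> V) ?P ((\<lambda>v. \<lambda>i\<in>{m}. - v i) \<circ> (\<lambda>\<omega>. ?e (Y \<omega>)))"
    by (rule indep_var_compose[OF indep]) auto
  moreover have "(\<lambda>v. \<lambda>i\<in>{m}. - v i) \<circ> (\<lambda>\<omega>. ?e (Y \<omega>)) = (\<lambda>\<omega>. ?e (- Y \<omega>))"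
    by (simp add: fun_eq_iff restrict_def)
  ultimately have indep': "indep_var N V ?P (\<lambda>\<omega>. ?e (- Y \<omega>))"
    by simp
  have "distr M ?P (\<lambda>\<omega>. ?e (Z \<omega>)) = distr (distr M borel Z) ?P ?e" if "Z \<in> borel_measurable M" for Z
    using that by (subst distr_distr) (auto simp: comp_def)
  then have "distr M ?P (\<lambda>\<omega>. ?e (- Y \<omega>)) = distr M ?P (\<lambda>\<omega>. ?e (Y \<omega>))"
    using sym by simp
  \<comment> \<open>By independence the joint law is the product of the marginals, so
    \<open>Y\<close> may be replaced by \<open>- Y\<close> beside the same \<open>V\<close>. Adding
    the two equal expectations then brings the paired values of \<open>f\<close> under one
    integral.\<close>
  then have joint: "distr M (N \<Otimes>\<^sub>M ?P) (\<lambda>\<omega>. (V \<omega>, ?e (Y \<omega>))) = distr M (N \<Otimes>\<^sub>M ?P) (\<lambda>\<omega>. (V \<omega>, ?e (- Y \<omega>)))"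
    using indep indep' unfolding indep_var_distribution_eq by metis
  let ?F = "\<lambda>(v, y). indicat_real S v * f (g v + y m)"
  have F[measurable]: "?F \<in> borel_measurable (N \<Otimes>\<^sub>M ?P)"
    by measurable
  have bd: "\<bar>indicat_real S v * f x\<bar> \<le> 1" for v x
    using bound[of x] by (auto simp: indicator_def)
  have int1: "integrable M (\<lambda>\<omega>. indicat_real S (V \<omega>) * f (g (V \<omega>) + Y \<omega>))"
    and int2: "integrable M (\<lambda>\<omega>. indicat_real S (V \<omega>) * f (g (V \<omega>) - Y \<omega>))"
    by (rule integrable_const_bound[where B = 1]; use bd in simp)+
  have "expectation (\<lambda>\<omega>. indicat_real S (V \<omega>) * f (g (V \<omega>) + Y \<omega>))
      = integral\<^sup>L (distr M (N \<Otimes>\<^sub>M ?P) (\<lambda>\<omega>. (V \<omega>, ?e (Y \<omega>)))) ?F"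
    by (subst integral_distr) auto
  also have "\<dots> = expectation (\<lambda>\<omega>. indicat_real S (V \<omega>) * f (g (V \<omega>) - Y \<omega>))"
    unfolding joint by (subst integral_distr) auto
  finally have "2 * expectation (\<lambda>\<omega>. indicat_real S (V \<omega>) * f (g (V \<omega>) + Y \<omega>))
      = expectation (\<lambda>\<omega>. indicat_real S (V \<omega>) * f (g (V \<omega>) + Y \<omega>)
          + indicat_real S (V \<omega>) * f (g (V \<omega>) - Y \<omega>))"
    using int1 int2 by simp
  also have "\<dots> \<ge> 0"
    using pair by (intro integral_nonneg_AE AE_I2) (auto simp: indicator_def)
  finally show ?thesis by simp
qed

section \<open>The reflection principle on a finite grid\<close>

context standard_wiener_process
begin

lemma increment_symmetric:
  assumes "0 \<le> s" "s < t"
  shows "distr M borel (\<lambda>\<omega>. - (X t \<omega> - X s \<omega>)) = distr M borel (\<lambda>\<omega>. X t \<omega> - X s \<omega>)"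
proof -
  let ?\<phi> = "normal_density 0 (sqrt (t - s))"
  have d: "distributed M lborel (\<lambda>\<omega>. X t \<omega> - X s \<omega>) ?\<phi>"
    using gaussian_increments assms by auto
  have "distributed M lborel (\<lambda>\<omega>. 0 + (-1) * (X t \<omega> - X s \<omega>)) (normal_density (0 + (-1) * 0) (\<bar>-1\<bar> * sqrt (t - s)))"
    by (rule normal_density_affine[OF d]) (use assms in auto)
  then have d': "distributed M lborel (\<lambda>\<omega>. - (X t \<omega> - X s \<omega>)) ?\<phi>"
    by simp
  have "distr M lborel (\<lambda>\<omega>. - (X t \<omega> - X s \<omega>)) = distr M lborel (\<lambda>\<omega>. X t \<omega> - X s \<omega>)"
    using distributed_distr_eq_density[OF d] distributed_distr_eq_density[OF d'] by simp
  moreover have "distr M lborel Z = distr M borel Z" for Z :: "'a \<Rightarrow> real"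
    by (rule distr_cong) auto
  ultimately show ?thesis by simp
qed

text \<open>The condition inside \<open>of_bool\<close> depends on the increments up to
  \<open>\<tau> (Suc k)\<close> alone and puts \<open>X (\<tau> (Suc k))\<close> outside
  \<open>I\<close>, within \<open>\<delta>\<close> of a point of \<open>I\<close>. The increment
  from there to \<open>t\<close> is symmetric and independent of that past, so the values of
  \<open>f\<close> can be paired as in \<open>pair\<close>.\<close>

lemma expectation_first_exit_nonneg:
  fixes f :: "real \<Rightarrow> real" and \<tau> :: "nat \<Rightarrow> real"
  assumes \<tau>: "\<tau> 0 = 0" "strict_mono_on {..Suc k} \<tau>" "\<tau> (Suc k) \<le> t"
    and I[measurable]: "I \<in> sets borel"
    and f[measurable]: "f \<in> borel_measurable borel"
    and bound: "\<And>x. \<bar>f x\<bar> \<le> 1"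
    and pair: "\<And>x x' y. x \<in> I \<Longrightarrow> \<bar>x' - x\<bar> < \<delta> \<Longrightarrow> x' \<notin> I \<Longrightarrow> 0 \<le> f (x' + y) + f (x' - y)"
  shows "0 \<le> expectation (\<lambda>\<omega>. of_bool ((\<forall>j\<le>k. X (\<tau> j) \<omega> \<in> I) \<and> X (\<tau> (Suc k)) \<omega> \<notin> I
      \<and> \<bar>X (\<tau> (Suc k)) \<omega> - X (\<tau> k) \<omega>\<bar> < \<delta>) * f (X t \<omega>))"
proof (cases "\<tau> (Suc k) = t")
  case True
  \<comment> \<open>No increment remains after the exit; \<open>pair\<close> with
    \<open>y = 0\<close> gives \<open>0 \<le> 2 * f (X t \<omega>)\<close>.\<close>
  show ?thesis
  proof (intro integral_nonneg_AE AE_I2)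
    fix \<omega>
    show "0 \<le> of_bool ((\<forall>j\<le>k. X (\<tau> j) \<omega> \<in> I) \<and> X (\<tau> (Suc k)) \<omega> \<notin> I
      \<and> \<bar>X (\<tau> (Suc k)) \<omega> - X (\<tau> k) \<omega>\<bar> < \<delta>) * f (X t \<omega>)"
      using pair[of "X (\<tau> k) \<omega>" "X (\<tau> (Suc k)) \<omega>" 0] True by auto
  qed
next
  case False
  \<comment> \<open>With \<open>t\<close> appended as the last time, the past is the block of
    increments \<open>{..k}\<close> and the future is the single increment with index
    \<open>Suc k\<close>.\<close>
  define s where "s = \<tau>(Suc (Suc k) := t)"
  have mono: "strict_mono_on {..Suc (Suc k)} s"
  proof (rule strict_mono_onI)
    fix i j assume ij: "i \<in> {..Suc (Suc k)}" "j \<in> {..Suc (Suc k)}" "i < j"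
    have "\<tau> i \<le> \<tau> (Suc k)"
      using strict_mono_onD[OF \<tau>(2), of i "Suc k"] ij by (cases "i = Suc k") auto
    then show "s i < s j"
      using strict_mono_onD[OF \<tau>(2), of i j] ij \<tau>(3) False by (auto simp: s_def)
  qed
  let ?D = "\<lambda>i \<omega>. X (s (Suc i)) \<omega> - X (s i) \<omega>"
  let ?N = "PiM {..k} (\<lambda>_. borel :: real measure)"
  let ?V = "\<lambda>\<omega>. restrict (\<lambda>i. ?D i \<omega>) {..k}"
  let ?g = "\<lambda>v. \<Sum>i\<le>k. v i :: real"
  have "indep_vars (\<lambda>_. borel) ?D {..<Suc (Suc k)}"
    using independent_increments[of s "Suc (Suc k)"] mono \<tau>(1) by (simp add: s_def)
  then have "indep_var ?N ?V (PiM {Suc k} (\<lambda>_. borel)) (\<lambda>\<omega>. restrict (\<lambda>i. ?D i \<omega>) {Suc k})"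
    by (rule indep_var_restrict) auto
  moreover have "(\<lambda>\<omega>. restrict (\<lambda>i. ?D i \<omega>) {Suc k}) = (\<lambda>\<omega>. \<lambda>i\<in>{Suc k}. X t \<omega> - X (\<tau> (Suc k)) \<omega>)"
    by (auto simp: s_def fun_eq_iff restrict_def)
  ultimately have indep: "indep_var ?N ?V (PiM {Suc k} (\<lambda>_. borel)) (\<lambda>\<omega>. \<lambda>i\<in>{Suc k}. X t \<omega> - X (\<tau> (Suc k)) \<omega>)"
    by simp
  \<comment> \<open>The exit event read off the vector of increments: since paths start at 0, its
    partial sums are the positions \<open>X (\<tau> j)\<close>, and entry \<open>k\<close> is the
    step that leaves \<open>I\<close>.\<close>
  define S where "S = {v \<in> space ?N. (\<forall>j\<in>{..k}. (\<Sum>i<j. v i) \<in> I) \<and> ?g v \<notin> I \<and> \<bar>v k\<bar> < \<delta>}"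
  have S: "S \<in> sets ?N"
    unfolding S_def by measurable
  have "0 \<le> \<tau> (Suc k)"
    using strict_mono_onD[OF \<tau>(2), of 0 "Suc k"] \<tau>(1) by simp
  then have sym: "distr M borel (\<lambda>\<omega>. - (X t \<omega> - X (\<tau> (Suc k)) \<omega>)) = distr M borel (\<lambda>\<omega>. X t \<omega> - X (\<tau> (Suc k)) \<omega>)"
    using False \<tau>(3) by (intro increment_symmetric) auto
  have partial: "(\<Sum>i<j. ?V \<omega> i) = X (\<tau> j) \<omega>" if "\<omega> \<in> space M" "j \<le> Suc k" for j \<omega>
  proof -
    have "(\<Sum>i<j. ?V \<omega> i) = (\<Sum>i<j. X (\<tau> (Suc i)) \<omega> - X (\<tau> i) \<omega>)"
      using that by (intro sum.cong) (auto simp: s_def)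
    then show ?thesis
      using start_at_zero[OF that(1)] \<tau>(1)
      unfolding sum_lessThan_telescope[of "\<lambda>i. X (\<tau> i) \<omega>"] by simp
  qed
  have total: "?g (?V \<omega>) = X (\<tau> (Suc k)) \<omega>" if "\<omega> \<in> space M" for \<omega>
    using partial[OF that, of "Suc k"] by (simp only: lessThan_Suc_atMost)
  have inS: "?V \<omega> \<in> S \<longleftrightarrow> (\<forall>j\<le>k. X (\<tau> j) \<omega> \<in> I) \<and> X (\<tau> (Suc k)) \<omega> \<notin> I
      \<and> \<bar>X (\<tau> (Suc k)) \<omega> - X (\<tau> k) \<omega>\<bar> < \<delta>" if "\<omega> \<in> space M" for \<omega>
  proof -
    have "?V \<omega> \<in> space ?N"
      by (simp add: space_PiM)
    moreover have "?V \<omega> k = X (\<tau> (Suc k)) \<omega> - X (\<tau> k) \<omega>"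
      by (simp add: s_def)
    moreover have "(\<Sum>i<j. ?V \<omega> i) = X (\<tau> j) \<omega>" if "j \<in> {..k}" for j
      using partial \<open>\<omega> \<in> space M\<close> that by auto
    ultimately show ?thesis
      unfolding S_def mem_Collect_eq total[OF that] by (metis (no_types, lifting) atMost_iff)
  qed
  have "0 \<le> expectation (\<lambda>\<omega>. indicator S (?V \<omega>) * f (?g (?V \<omega>) + (X t \<omega> - X (\<tau> (Suc k)) \<omega>)))"
  proof (rule expectation_symmetric_nonneg[where g = ?g, OF indep _ sym S])
    fix v y assume v: "v \<in> S"
    have "?g v = (\<Sum>i<k. v i) + v k"
      by (simp flip: lessThan_Suc_atMost)
    then show "0 \<le> f (?g v + y) + f (?g v - y)"
      using v by (intro pair[of "\<Sum>i<k. v i"]) (auto simp: S_def)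
  next
    show "(\<lambda>\<omega>. X t \<omega> - X (\<tau> (Suc k)) \<omega>) \<in> borel_measurable M"
      using \<open>0 \<le> \<tau> (Suc k)\<close> \<tau>(3) random_variable_at by auto
  qed (use bound in auto)
  also have "\<dots> = expectation (\<lambda>\<omega>. of_bool ((\<forall>j\<le>k. X (\<tau> j) \<omega> \<in> I) \<and> X (\<tau> (Suc k)) \<omega> \<notin> I
      \<and> \<bar>X (\<tau> (Suc k)) \<omega> - X (\<tau> k) \<omega>\<bar> < \<delta>) * f (X t \<omega>))"
  proof (rule Bochner_Integration.integral_cong[OF refl])
    fix \<omega> assume "\<omega> \<in> space M"
    then show "indicator S (?V \<omega>) * f (?g (?V \<omega>) + (X t \<omega> - X (\<tau> (Suc k)) \<omega>)) =
      of_bool ((\<forall>j\<le>k. X (\<tau> j) \<omega> \<in> I) \<and> X (\<tau> (Suc k)) \<omega> \<notin> I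
      \<and> \<bar>X (\<tau> (Suc k)) \<omega> - X (\<tau> k) \<omega>\<bar> < \<delta>) * f (X t \<omega>)"
      unfolding indicator_def inS[OF \<open>\<omega> \<in> space M\<close>] total[OF \<open>\<omega> \<in> space M\<close>] by simp
  qed
  finally show ?thesis .
qed


definition grid_stay :: "real \<Rightarrow> nat \<Rightarrow> real set \<Rightarrow> 'a set" where
  "grid_stay t N I = {\<omega> \<in> space M. \<forall>j\<le>N. X (t * j / N) \<omega> \<in> I}"

text \<open>Outside this event, a path that leaves \<open>I\<close> along the grid lands less than
  \<open>\<delta>\<close> away from its previous position in \<open>I\<close>, which controls the
  overshoot.\<close>

definition grid_jump :: "real \<Rightarrow> nat \<Rightarrow> real \<Rightarrow> 'a set" where
  "grid_jump t N \<delta> = {\<omega> \<in> space M. \<exists>j<N. \<delta> \<le> \<bar>X (t * Suc j / N) \<omega> - X (t * j / N) \<omega>\<bar>}"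

lemma sets_grid_stay:
  assumes "0 \<le> t" and [measurable]: "I \<in> sets borel"
  shows "grid_stay t N I \<in> events"
proof -
  have [measurable]: "\<And>j. X (t * real j / real N) \<in> borel_measurable M"
    using assms(1) by (intro random_variable_at) auto
  have "{\<omega> \<in> space M. \<forall>j\<in>{..N}. X (t * j / N) \<omega> \<in> I} \<in> events"
    by measurable
  then show ?thesis
    by (simp add: grid_stay_def atMost_def)
qed

lemma sets_grid_jump:
  assumes "0 \<le> t"
  shows "grid_jump t N \<delta> \<in> events"
proof -
  have [measurable]: "\<And>j. X (t * real j / real N) \<in> borel_measurable M"
    using assms by (intro random_variable_at) auto
  have "{\<omega> \<in> space M. \<exists>j\<in>{..<N}. \<delta> \<le> \<bar>X (t * Suc j / N) \<omega> - X (t * j / N) \<omega>\<bar>} \<in> events"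
    by measurable
  then show ?thesis
    by (simp only: grid_jump_def lessThan_iff Bex_def)
qed

text \<open>The expectation is split by the first grid exit from \<open>I\<close>: without exit
  \<open>f\<close> equals \<open>c\<close>, an exit by a step below \<open>\<delta>\<close>
  contributes a nonnegative amount, and a larger step is charged to \<open>grid_jump\<close> using
  \<open>\<bar>f x\<bar> \<le> 1\<close>. The constant \<open>c\<close> serves both directions: 1
  for upper bounds on staying, and -1 with \<open>- f\<close> for lower bounds.\<close>

lemma expectation_grid_bound:
  fixes f :: "real \<Rightarrow> real"
  assumes t: "0 < t" and N: "0 < N" and zero: "0 \<in> I"
    and I: "I \<in> sets borel"
    and f[measurable]: "f \<in> borel_measurable borel"
    and bound: "\<And>x. \<bar>f x\<bar> \<le> 1"
    and const: "\<And>x. x \<in> I \<Longrightarrow> f x = c"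
    and pair: "\<And>x x' y. x \<in> I \<Longrightarrow> \<bar>x' - x\<bar> < \<delta> \<Longrightarrow> x' \<notin> I \<Longrightarrow> 0 \<le> f (x' + y) + f (x' - y)"
  shows "c * prob (grid_stay t N I) - prob (grid_jump t N \<delta>) \<le> expectation (\<lambda>\<omega>. f (X t \<omega>))"
proof -
  let ?A = "grid_stay t N I" and ?E = "grid_jump t N \<delta>"
  define \<tau> where "\<tau> j = t * real j / real N" for j :: nat
  let ?Q = "\<lambda>k \<omega>. (\<forall>j\<le>k. X (\<tau> j) \<omega> \<in> I) \<and> X (\<tau> (Suc k)) \<omega> \<notin> I
      \<and> \<bar>X (\<tau> (Suc k)) \<omega> - X (\<tau> k) \<omega>\<bar> < \<delta>"
  have [measurable]: "X (\<tau> j) \<in> borel_measurable M" for j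
    using t by (intro random_variable_at) (auto simp: \<tau>_def)
  have [measurable]: "X t \<in> borel_measurable M"
    using t by (intro random_variable_at) auto
  have sets_AE: "?A \<in> events" "?E \<in> events"
    using sets_grid_stay sets_grid_jump t I by auto
  note [measurable] = I
  have \<tau>0: "\<tau> 0 = 0" and \<tau>N: "\<tau> N = t" and \<tau>_less: "strict_mono \<tau>"
    using N t by (auto simp: \<tau>_def strict_mono_def field_simps)
  have Q_nonneg: "0 \<le> expectation (\<lambda>\<omega>. of_bool (?Q k \<omega>) * f (X t \<omega>))" if "k < N" for k
  proof (rule expectation_first_exit_nonneg[where I = I])
    show "strict_mono_on {..Suc k} \<tau>"
      using \<tau>_less by (auto simp: strict_mono_on_def strict_mono_def)
    show "\<tau> (Suc k) \<le> t"
      using that \<tau>N strict_mono_less_eq[OF \<tau>_less, of "Suc k" N] by auto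
  qed (use \<tau>0 I bound pair in auto)
  have Qset: "Measurable.pred M (?Q k)" for k
  proof -
    have "Measurable.pred M (\<lambda>\<omega>. (\<forall>j\<in>{..k}. X (\<tau> j) \<omega> \<in> I) \<and> X (\<tau> (Suc k)) \<omega> \<notin> I
      \<and> \<bar>X (\<tau> (Suc k)) \<omega> - X (\<tau> k) \<omega>\<bar> < \<delta>)"
      by measurable
    then show ?thesis
      by (simp add: atMost_def)
  qed
  have Qint: "integrable M (\<lambda>\<omega>. of_bool (?Q k \<omega>) * f (X t \<omega>))" for k
  proof (rule integrable_const_bound[where B = 1])
    show "(\<lambda>\<omega>. of_bool (?Q k \<omega>) * f (X t \<omega>)) \<in> borel_measurable M"
      using Qset[of k] by (intro borel_measurable_times) (auto simp: of_bool_def)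
  qed (use bound in \<open>auto simp: of_bool_def\<close>)
  have fint: "integrable M (\<lambda>\<omega>. f (X t \<omega>))"
    by (rule integrable_const_bound[where B = 1]) (use bound in auto)
  have int_AE: "integrable M (indicat_real ?A)" "integrable M (indicat_real ?E)"
    using sets_AE by (auto simp: less_top[symmetric])
  \<comment> \<open>The events \<open>?Q k\<close> describe first exits, hence are disjoint for
    distinct \<open>k\<close>, and at most one summand is nonzero.\<close>
  have pointwise: "(\<Sum>k<N. of_bool (?Q k \<omega>) * f (X t \<omega>))
      \<le> f (X t \<omega>) - c * indicator ?A \<omega> + indicator ?E \<omega>" if \<omega>: "\<omega> \<in> space M" for \<omega>
  proof (cases "\<omega> \<in> ?A")
    case True
    then have in_I: "X (\<tau> j) \<omega> \<in> I" if "j \<le> N" for j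
      using that by (auto simp: grid_stay_def \<tau>_def)
    then have sum0: "(\<Sum>k<N. of_bool (?Q k \<omega>) * f (X t \<omega>)) = 0"
      by (intro sum.neutral) auto
    have "f (X t \<omega>) = c"
      using in_I[of N] \<tau>N const by auto
    then show ?thesis
      using True unfolding sum0 by simp
  next
    case False
    then have "\<exists>j. j \<le> N \<and> X (\<tau> j) \<omega> \<notin> I"
      using \<omega> by (auto simp: grid_stay_def \<tau>_def)
    then obtain n where n: "n \<le> N" "X (\<tau> n) \<omega> \<notin> I" "\<And>j. j < n \<Longrightarrow> j \<le> N \<Longrightarrow> X (\<tau> j) \<omega> \<in> I"
      using exists_least_iff[of "\<lambda>j. j \<le> N \<and> X (\<tau> j) \<omega> \<notin> I"] by auto
    have "n \<noteq> 0"
      using n(2) zero start_at_zero[OF \<omega>] \<tau>0 by (intro notI) simp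
    then obtain k0 where k0: "n = Suc k0"
      by (cases n) auto
    have "k = k0" if "?Q k \<omega>" "k < N" for k
      using that n k0 by (metis Suc_leI less_Suc_eq_le linorder_neqE_nat)
    then have "(\<Sum>k<N. of_bool (?Q k \<omega>) * f (X t \<omega>)) = (\<Sum>k\<in>{k0}. of_bool (?Q k \<omega>) * f (X t \<omega>))"
    proof (intro sum.mono_neutral_right ballI)
      fix k assume "k \<in> {..<N} - {k0}"
      then have "\<not> ?Q k \<omega>"
        using \<open>\<And>k. ?Q k \<omega> \<Longrightarrow> k < N \<Longrightarrow> k = k0\<close> by blast
      then show "of_bool (?Q k \<omega>) * f (X t \<omega>) = 0"
        by (simp only: of_bool_eq mult_zero_left)
    qed (use n(1) k0 in auto)
    also have "\<dots> = of_bool (?Q k0 \<omega>) * f (X t \<omega>)"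
      by simp
    \<comment> \<open>If the exiting step is below \<open>\<delta>\<close>, the left side is
      \<open>f (X t \<omega>)\<close>; otherwise it is 0 and the indicator compensates a value of
      \<open>f\<close> that may be as low as -1.\<close>
    also have "\<dots> \<le> f (X t \<omega>) + indicator ?E \<omega>"
    proof (cases "\<bar>X (\<tau> (Suc k0)) \<omega> - X (\<tau> k0) \<omega>\<bar> < \<delta>")
      case True
      then have "?Q k0 \<omega>"
        using n k0 by auto
      then show ?thesis
        by (auto simp: indicator_def)
    next
      case False
      then have "\<omega> \<in> ?E"
        using \<omega> n(1) k0 by (auto simp: grid_jump_def \<tau>_def intro!: exI[of _ k0])
      then show ?thesis
        using False bound[of "X t \<omega>"] by auto
    qed
    finally show ?thesis
      using False by simp
  qed
  have "0 \<le> (\<Sum>k<N. expectation (\<lambda>\<omega>. of_bool (?Q k \<omega>) * f (X t \<omega>)))"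
    using Q_nonneg by (intro sum_nonneg) auto
  also have "\<dots> = expectation (\<lambda>\<omega>. \<Sum>k<N. of_bool (?Q k \<omega>) * f (X t \<omega>))"
    using Qint by (intro Bochner_Integration.integral_sum[symmetric])
  also have "\<dots> \<le> expectation (\<lambda>\<omega>. f (X t \<omega>) - c * indicator ?A \<omega> + indicator ?E \<omega>)"
  proof (rule integral_mono)
    show "integrable M (\<lambda>\<omega>. f (X t \<omega>) - c * indicator ?A \<omega> + indicator ?E \<omega>)"
      using fint int_AE by simp
  qed (use pointwise in \<open>intro Bochner_Integration.integrable_sum Qint | assumption\<close>)+
  also have "\<dots> = expectation (\<lambda>\<omega>. f (X t \<omega>)) - c * prob ?A + prob ?E"
    using fint int_AE by (simp add: sets_AE)
  finally show ?thesis by simp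
qed

section \<open>From the grid to continuous time\<close>

lemma path_uniformly_continuous:
  assumes "\<omega> \<in> space M" "0 < e"
  obtains d where "0 < d"
    "\<And>s u. s \<in> {0..t} \<Longrightarrow> u \<in> {0..t} \<Longrightarrow> \<bar>s - u\<bar> < d \<Longrightarrow> \<bar>X s \<omega> - X u \<omega>\<bar> < e"
proof -
  have "uniformly_continuous_on {0..t} (\<lambda>s. X s \<omega>)"
    using continuous_on_subset[OF continuous_paths[OF assms(1)], of "{0..t}"]
    by (intro compact_uniformly_continuous) auto
  then show thesis
    using assms(2) that unfolding uniformly_continuous_on_def dist_real_def by metis
qed

lemma eventually_grid_mesh_less:
  assumes "0 < d"
  shows "eventually (\<lambda>n. t / real (Suc n) < d) sequentially"
proof -
  have "(\<lambda>n. t / real (Suc n)) \<longlonglongrightarrow> 0"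
    by real_asymp
  then show ?thesis
    using assms by (rule order_tendstoD)
qed

text \<open>Each path is uniformly continuous on \<open>{0..t}\<close>, so on fine grids all its
  steps are below \<open>\<delta>\<close>. Grids have \<open>Suc n\<close> steps because division by
  0 would collapse every grid point to time 0.\<close>

lemma prob_grid_jump_tendsto_0:
  assumes "0 < t" "0 < \<delta>"
  shows "(\<lambda>n. prob (grid_jump t (Suc n) \<delta>)) \<longlonglongrightarrow> 0"
proof (rule measure_tendsto_0_if_eventually_notin)
  fix \<omega> assume \<omega>: "\<omega> \<in> space M"
  obtain d where d: "0 < d"
    "\<And>s u. s \<in> {0..t} \<Longrightarrow> u \<in> {0..t} \<Longrightarrow> \<bar>s - u\<bar> < d \<Longrightarrow> \<bar>X s \<omega> - X u \<omega>\<bar> < \<delta>"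
    using path_uniformly_continuous[where t = t, OF \<omega> assms(2)] by blast
  show "eventually (\<lambda>n. \<omega> \<notin> grid_jump t (Suc n) \<delta>) sequentially"
    using eventually_grid_mesh_less[OF d(1), of t]
  proof eventually_elim
    case (elim n)
    have "\<bar>X (t * Suc j / Suc n) \<omega> - X (t * j / Suc n) \<omega>\<bar> < \<delta>" if "j < Suc n" for j
    proof (rule d(2))
      have "t * Suc j / Suc n - t * j / Suc n = t / Suc n"
        by (simp add: diff_divide_distrib[symmetric] algebra_simps)
      then show "\<bar>t * Suc j / Suc n - t * j / Suc n\<bar> < d"
        using elim assms(1) by simp
    qed (use that assms(1) grid_point_mem[of t _ "Suc n"] in \<open>auto simp del: of_nat_Suc\<close>)
    then show ?case
      by (auto simp: grid_jump_def not_le)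
  qed
qed (use sets_grid_jump assms(1) in auto)

text \<open>Near the time of violation there is a grid point at which the path differs by less than
  \<open>\<delta>\<close>, hence lies outside the interval shrunk by \<open>\<delta>\<close>. The
  shrinking is what lets the grid detect an exit between grid points.\<close>

lemma eventually_not_grid_stay:
  assumes \<omega>: "\<omega> \<in> space M" and t: "0 < t" and \<delta>: "0 < \<delta>"
    and exit: "\<not> (\<forall>\<tau>\<in>{0..t}. l < X \<tau> \<omega> \<and> X \<tau> \<omega> < r)"
  shows "eventually (\<lambda>n. \<omega> \<notin> grid_stay t (Suc n) {l + \<delta><..<r - \<delta>}) sequentially"
proof -
  obtain \<tau> where \<tau>: "\<tau> \<in> {0..t}" "X \<tau> \<omega> \<le> l \<or> r \<le> X \<tau> \<omega>"
    using exit by (auto simp: not_less)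
  obtain d where d: "0 < d"
    "\<And>s u. s \<in> {0..t} \<Longrightarrow> u \<in> {0..t} \<Longrightarrow> \<bar>s - u\<bar> < d \<Longrightarrow> \<bar>X s \<omega> - X u \<omega>\<bar> < \<delta>"
    using path_uniformly_continuous[where t = t, OF \<omega> \<delta>] by blast
  show ?thesis
    using eventually_grid_mesh_less[OF d(1), of t]
  proof eventually_elim
    case (elim n)
    \<comment> \<open>The index of the last grid point not after \<open>\<tau>\<close>.\<close>
    define j where "j = nat \<lfloor>\<tau> * Suc n / t\<rfloor>"
    have "0 \<le> \<tau> * Suc n / t"
      using \<tau>(1) t by auto
    then have "real j = of_int \<lfloor>\<tau> * Suc n / t\<rfloor>"
      unfolding j_def by (intro of_nat_nat) (simp only: zero_le_floor)
    then have j: "real j \<le> \<tau> * Suc n / t" "\<tau> * Suc n / t < real j + 1"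
      using floor_correct[of "\<tau> * Suc n / t"] by auto
    have "\<tau> * Suc n / t \<le> Suc n"
      using \<tau>(1) t mult_right_mono[of \<tau> t "real (Suc n)"] by (simp add: divide_le_eq mult.commute)
    then have jn: "j \<le> Suc n"
      using j(1) by linarith
    let ?u = "t * j / Suc n"
    have u: "?u \<le> \<tau>" "\<tau> < ?u + t / Suc n"
      using j t by (simp_all add: field_simps del: of_nat_Suc)
    have "\<bar>X \<tau> \<omega> - X ?u \<omega>\<bar> < \<delta>"
      using u elim \<tau>(1) t jn grid_point_mem[of t j "Suc n"] by (intro d(2)) auto
    then have "X ?u \<omega> \<notin> {l + \<delta><..<r - \<delta>}"
      using \<tau>(2) by auto
    then show ?case
      using jn by (auto simp: grid_stay_def)
  qed
qed

definition stay :: "real \<Rightarrow> real \<Rightarrow> real \<Rightarrow> 'a set" where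
  "stay t l r = {\<omega> \<in> space M. \<forall>\<tau>\<in>{0..t}. l < X \<tau> \<omega> \<and> X \<tau> \<omega> < r}"

text \<open>By compactness a path that stays in the open interval keeps a positive distance, more
  than some \<open>1 / Suc m\<close>, from both ends. The uncountable intersection over times thus
  becomes a countable combination of grid events; the converse inclusion is the detection of exits
  by fine grids.\<close>

lemma sets_stay:
  assumes t: "0 < t"
  shows "stay t l r \<in> events"
proof -
  have "stay t l r = (\<Union>m. \<Inter>n. grid_stay t (Suc n) {l + 1 / Suc m<..<r - 1 / Suc m})" (is "_ = ?R")
  proof (intro equalityI subsetI)
    fix \<omega> assume "\<omega> \<in> stay t l r"
    then have \<omega>: "\<omega> \<in> space M" and st: "\<And>\<tau>. \<tau> \<in> {0..t} \<Longrightarrow> l < X \<tau> \<omega> \<and> X \<tau> \<omega> < r"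
      by (auto simp: stay_def)
    have nonempty: "{0..t} \<noteq> {}"
      using t by auto
    have "continuous_on {0..t} (\<lambda>s. min (X s \<omega> - l) (r - X s \<omega>))"
      by (intro continuous_intros continuous_on_subset[OF continuous_paths[OF \<omega>]]) auto
    with compact_Icc nonempty obtain \<tau>0 where \<tau>0: "\<tau>0 \<in> {0..t}"
      "\<And>\<tau>. \<tau> \<in> {0..t} \<Longrightarrow> min (X \<tau>0 \<omega> - l) (r - X \<tau>0 \<omega>) \<le> min (X \<tau> \<omega> - l) (r - X \<tau> \<omega>)"
      by (blast dest: continuous_attains_inf)
    have "0 < min (X \<tau>0 \<omega> - l) (r - X \<tau>0 \<omega>)"
      using st[OF \<tau>0(1)] by auto
    then obtain m where m: "1 / Suc m < min (X \<tau>0 \<omega> - l) (r - X \<tau>0 \<omega>)"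
      using nat_approx_posE by blast
    have "\<omega> \<in> grid_stay t (Suc n) {l + 1 / Suc m<..<r - 1 / Suc m}" for n
    proof -
      have "X (t * j / Suc n) \<omega> \<in> {l + 1 / Suc m<..<r - 1 / Suc m}" if "j \<le> Suc n" for j
      proof -
        have "t * j / Suc n \<in> {0..t}"
          using that t by (intro grid_point_mem) auto
        then show ?thesis
          using \<tau>0(2) m by fastforce
      qed
      then show ?thesis
        using \<omega> by (auto simp: grid_stay_def)
    qed
    then show "\<omega> \<in> ?R"
      by auto
  next
    fix \<omega> assume "\<omega> \<in> ?R"
    then obtain m where m: "\<And>n. \<omega> \<in> grid_stay t (Suc n) {l + 1 / Suc m<..<r - 1 / Suc m}"
      by auto
    then have \<omega>: "\<omega> \<in> space M"
      by (auto simp: grid_stay_def)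
    show "\<omega> \<in> stay t l r"
    proof (rule ccontr)
      assume "\<omega> \<notin> stay t l r"
      then have "eventually (\<lambda>n. \<omega> \<notin> grid_stay t (Suc n) {l + 1 / Suc m<..<r - 1 / Suc m}) sequentially"
        using \<omega> t by (intro eventually_not_grid_stay) (auto simp: stay_def)
      then show False
        using m by auto
    qed
  qed
  then show ?thesis
    using sets_grid_stay t by auto
qed

text \<open>Staying at all times implies staying on every grid, so the grid bound with
  \<open>c = 1\<close> on \<open>{l<..<r}\<close> applies; its jump term vanishes as the grid is
  refined.\<close>

lemma prob_stay_le_expectation:
  fixes f :: "real \<Rightarrow> real"
  assumes t: "0 < t" and "l < 0" "0 < r" "0 < \<delta>"
    and f: "f \<in> borel_measurable borel" "\<And>x. \<bar>f x\<bar> \<le> 1" "\<And>x. x \<in> {l<..<r} \<Longrightarrow> f x = 1"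
    and pair: "\<And>x y. x \<in> {l - \<delta><..l} \<union> {r..<r + \<delta>} \<Longrightarrow> 0 \<le> f (x + y) + f (x - y)"
  shows "prob (stay t l r) \<le> expectation (\<lambda>\<omega>. f (X t \<omega>))"
proof -
  have "prob (stay t l r) - prob (grid_jump t (Suc n) \<delta>) \<le> expectation (\<lambda>\<omega>. f (X t \<omega>))" for n
  proof -
    have "stay t l r \<subseteq> grid_stay t (Suc n) {l<..<r}"
      using t grid_point_mem[of t _ "Suc n"] by (auto simp: stay_def grid_stay_def simp del: of_nat_Suc)
    then have "prob (stay t l r) \<le> prob (grid_stay t (Suc n) {l<..<r})"
      using sets_grid_stay t by (intro finite_measure_mono) auto
    moreover have "1 * prob (grid_stay t (Suc n) {l<..<r}) - prob (grid_jump t (Suc n) \<delta>)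
        \<le> expectation (\<lambda>\<omega>. f (X t \<omega>))"
      by (rule expectation_grid_bound) (use assms in auto)
    ultimately show ?thesis by simp
  qed
  moreover have "(\<lambda>n. prob (stay t l r) - prob (grid_jump t (Suc n) \<delta>)) \<longlonglongrightarrow> prob (stay t l r) - 0"
    using t \<open>0 < \<delta>\<close> by (intro tendsto_intros prob_grid_jump_tendsto_0)
  ultimately show ?thesis
    by (intro LIMSEQ_le_const2) auto
qed

text \<open>The grid bound for \<open>- f\<close> and \<open>c = -1\<close> on the interval shrunk
  by \<open>\<delta>\<close>. A path may stay on the grid and leave in between, but the shrinking
  makes the probability of \<open>?A n - stay t l r\<close> tend to 0.\<close>

lemma expectation_le_prob_stay:
  fixes f :: "real \<Rightarrow> real"
  assumes t: "0 < t" and "l + \<delta> < 0" "0 < r - \<delta>" "0 < \<delta>"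
    and f: "f \<in> borel_measurable borel" "\<And>x. \<bar>f x\<bar> \<le> 1" "\<And>x. x \<in> {l + \<delta><..<r - \<delta>} \<Longrightarrow> f x = 1"
    and pair: "\<And>x y. x \<in> {l<..l + \<delta>} \<union> {r - \<delta>..<r} \<Longrightarrow> f (x + y) + f (x - y) \<le> 0"
  shows "expectation (\<lambda>\<omega>. f (X t \<omega>)) \<le> prob (stay t l r)"
proof -
  let ?A = "\<lambda>n. grid_stay t (Suc n) {l + \<delta><..<r - \<delta>}"
  have "expectation (\<lambda>\<omega>. f (X t \<omega>)) - prob (grid_jump t (Suc n) \<delta>) - prob (?A n - stay t l r)
      \<le> prob (stay t l r)" for n
  proof -
    have "-1 * prob (?A n) - prob (grid_jump t (Suc n) \<delta>) \<le> expectation (\<lambda>\<omega>. - f (X t \<omega>))"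
    proof (rule expectation_grid_bound)
      fix x x' y assume "x \<in> {l + \<delta><..<r - \<delta>}" "\<bar>x' - x\<bar> < \<delta>" "x' \<notin> {l + \<delta><..<r - \<delta>}"
      then have "x' \<in> {l<..l + \<delta>} \<union> {r - \<delta>..<r}"
        by auto
      from pair[OF this, of y] show "0 \<le> - f (x' + y) + - f (x' - y)"
        by simp
    qed (use assms in auto)
    moreover have "prob (?A n) \<le> prob (stay t l r) + prob (?A n - stay t l r)"
    proof -
      have "prob (?A n) \<le> prob (stay t l r \<union> (?A n - stay t l r))"
        using sets_grid_stay sets_stay t by (intro finite_measure_mono) auto
      also have "\<dots> \<le> prob (stay t l r) + prob (?A n - stay t l r)"
        using sets_grid_stay sets_stay t by (intro measure_Un_le) auto
      finally show ?thesis .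
    qed
    ultimately show ?thesis by simp
  qed
  moreover have "(\<lambda>n. prob (?A n - stay t l r)) \<longlonglongrightarrow> 0"
  proof (rule measure_tendsto_0_if_eventually_notin)
    fix \<omega> assume \<omega>: "\<omega> \<in> space M"
    show "eventually (\<lambda>n. \<omega> \<notin> ?A n - stay t l r) sequentially"
    proof (cases "\<omega> \<in> stay t l r")
      case False
      then have "eventually (\<lambda>n. \<omega> \<notin> ?A n) sequentially"
        using \<omega> t \<open>0 < \<delta>\<close> by (intro eventually_not_grid_stay) (auto simp: stay_def)
      then show ?thesis
        by eventually_elim auto
    qed auto
  qed (use sets_grid_stay sets_stay t in auto)
  then have "(\<lambda>n. expectation (\<lambda>\<omega>. f (X t \<omega>)) - prob (grid_jump t (Suc n) \<delta>) - prob (?A n - stay t l r))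
      \<longlonglongrightarrow> expectation (\<lambda>\<omega>. f (X t \<omega>)) - 0 - 0"
    using t \<open>0 < \<delta>\<close> by (intro tendsto_intros prob_grid_jump_tendsto_0)
  ultimately show ?thesis
    by (intro LIMSEQ_le_const2) auto
qed


section \<open>The law of \<open>X t\<close>\<close>

text \<open>The image bounds are stated through this function, whose continuity lets the shift
  \<open>\<delta>\<close> tend to 0; Gaussian integrals are substituted afterwards.\<close>

definition marginal_cdf :: "real \<Rightarrow> real \<Rightarrow> real" where
  "marginal_cdf t = cdf (distr M borel (X t))"

lemma marginal_density:
  assumes "0 < t"
  shows "distributed M lborel (X t) (normal_density 0 (sqrt t))"
proof -
  have "distributed M lborel (\<lambda>\<omega>. X t \<omega> - X 0 \<omega>) (normal_density 0 (sqrt t))"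
    using gaussian_increments[of 0 t] assms by simp
  moreover have "distr M lborel (\<lambda>\<omega>. X t \<omega> - X 0 \<omega>) = distr M lborel (X t)"
    by (rule distr_cong) (auto simp: start_at_zero)
  moreover have "X t \<in> borel_measurable M"
    using random_variable_at assms by auto
  ultimately show ?thesis
    by (simp add: distributed_def)
qed

lemma marginal_real_distribution:
  assumes "0 \<le> t"
  shows "real_distribution (distr M borel (X t))"
  using random_variable_at[OF assms] by (rule real_distribution_distr)

text \<open>A law with a density is absolutely continuous. This makes the cdf continuous and gives
  open and closed intervals the same cdf differences.\<close>

lemma marginal_no_atoms:
  assumes "0 < t"
  shows "measure (distr M borel (X t)) {x} = 0"
proof -
  have "distr M borel (X t) = distr M lborel (X t)"
    by (rule distr_cong) auto
  also have "\<dots> = density lborel (normal_density 0 (sqrt t))"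
    using marginal_density[OF assms] by (rule distributed_distr_eq_density)
  also have "emeasure \<dots> {x} = 0"
    using absolutely_continuousI_density[of "\<lambda>x. ennreal (normal_density 0 (sqrt t) x)" lborel]
    by (auto simp: absolutely_continuous_def dest!: subsetD[where c = "{x}"])
  finally show ?thesis
    by (simp add: measure_def)
qed

lemma isCont_marginal_cdf:
  assumes "0 < t"
  shows "isCont (marginal_cdf t) x"
proof -
  interpret \<mu>: real_distribution "distr M borel (X t)"
    using marginal_real_distribution assms by simp
  show ?thesis
    using marginal_no_atoms[OF assms] by (simp add: marginal_cdf_def \<mu>.isCont_cdf)
qed

lemma marginal_intervals:
  assumes t: "0 < t"
  shows "measure (distr M borel (X t)) {..u} = marginal_cdf t u"
    and "measure (distr M borel (X t)) {u..} = 1 - marginal_cdf t u"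
    and "u \<le> v \<Longrightarrow> measure (distr M borel (X t)) {u..v} = marginal_cdf t v - marginal_cdf t u"
    and "u < v \<Longrightarrow> measure (distr M borel (X t)) {u<..<v} = marginal_cdf t v - marginal_cdf t u"
proof -
  interpret \<mu>: real_distribution "distr M borel (X t)"
    using marginal_real_distribution t by simp
  let ?m = "measure (distr M borel (X t))"
  note atom = marginal_no_atoms[OF t]
  have Ioc: "?m {u<..v} = marginal_cdf t v - marginal_cdf t u" if "u \<le> v" for u v
    using \<mu>.cdf_diff_eq[of u v] that by (cases "u = v") (auto simp: marginal_cdf_def)
  show 1: "?m {..u} = marginal_cdf t u"
    by (simp add: marginal_cdf_def cdf_def)
  have "?m {u..} = ?m (UNIV - {..u} \<union> {u})"
    by (rule arg_cong[where f = ?m]) auto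
  also have "\<dots> = ?m (UNIV - {..u}) + ?m {u}"
    by (rule \<mu>.finite_measure_Union) auto
  also have "?m (UNIV - {..u}) = 1 - ?m {..u}"
    using \<mu>.prob_compl[of "{..u}"] by simp
  finally show "?m {u..} = 1 - marginal_cdf t u"
    using 1 atom by simp
  show "?m {u..v} = marginal_cdf t v - marginal_cdf t u" if "u \<le> v"
  proof -
    have "?m {u..v} = ?m ({u<..v} \<union> {u})"
      using that by (intro arg_cong[where f = ?m]) auto
    also have "\<dots> = ?m {u<..v} + ?m {u}"
      by (rule \<mu>.finite_measure_Union) auto
    finally show ?thesis
      using Ioc that atom by simp
  qed
  show "?m {u<..<v} = marginal_cdf t v - marginal_cdf t u" if "u < v"
  proof -
    have "?m {u<..v} = ?m ({u<..<v} \<union> {v})"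
      using that by (intro arg_cong[where f = ?m]) auto
    also have "\<dots> = ?m {u<..<v} + ?m {v}"
      by (rule \<mu>.finite_measure_Union) auto
    finally show ?thesis
      using Ioc[of u v] that atom by simp
  qed
qed

lemma expectation_two_indicators:
  assumes "0 \<le> t" "A \<in> sets borel" "B \<in> sets borel"
  shows "expectation (\<lambda>\<omega>. 1 - 2 * indicat_real A (X t \<omega>) - 2 * indicat_real B (X t \<omega>))
    = 1 - 2 * measure (distr M borel (X t)) A - 2 * measure (distr M borel (X t)) B"
proof -
  interpret \<mu>: real_distribution "distr M borel (X t)"
    using marginal_real_distribution assms by simp
  have [measurable]: "X t \<in> borel_measurable M"
    using random_variable_at assms by simp
  have "expectation (\<lambda>\<omega>. 1 - 2 * indicat_real A (X t \<omega>) - 2 * indicat_real B (X t \<omega>))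
      = (\<integral>x. 1 - 2 * indicat_real A x - 2 * indicat_real B x \<partial>distr M borel (X t))"
    using assms by (subst integral_distr) auto
  also have "\<dots> = 1 - 2 * measure (distr M borel (X t)) A - 2 * measure (distr M borel (X t)) B"
    using assms \<mu>.prob_space \<mu>.emeasure_finite by (simp add: less_top[symmetric])
  finally show ?thesis .
qed

section \<open>Upper and lower bounds by the method of images\<close>

text \<open>The images are taken after one reflection at each end: the test function is -1 on both
  image intervals and 1 elsewhere. Its expectation is computed for each \<open>\<delta> > 0\<close>,
  and then \<open>\<delta>\<close> tends to 0.\<close>

lemma prob_stay_upper_bound:
  assumes t: "0 < t" and l: "l < 0" and r: "0 < r"
  shows "prob (stay t l r) \<le> 1 - 2 * (marginal_cdf t (2 * r - l) - marginal_cdf t r)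
      - 2 * (marginal_cdf t l - marginal_cdf t (2 * l - r))"
proof -
  let ?C = "marginal_cdf t"
  let ?U = "\<lambda>\<delta>. 1 - 2 * (?C (2 * r - l + \<delta>) - ?C (r + \<delta>)) - 2 * (?C (l - \<delta>) - ?C (2 * l - r - \<delta>))"
  have "prob (stay t l r) \<le> ?U \<delta>" if \<delta>: "0 < \<delta>" for \<delta>
  proof -
    \<comment> \<open>The images of \<open>(l, r)\<close> under reflection in \<open>r\<close> and \<open>l\<close>, moved outwards: for \<open>x\<close> in the
      overshoot zone, \<open>x + y\<close> and \<open>x - y\<close> cannot both lie in their union.\<close>
    let ?A = "{r + \<delta><..<2 * r - l + \<delta>}" and ?B = "{2 * l - r - \<delta><..<l - \<delta>}"
    let ?f = "\<lambda>x. 1 - 2 * indicator ?A x - 2 * indicator ?B x :: real"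
    have "prob (stay t l r) \<le> expectation (\<lambda>\<omega>. ?f (X t \<omega>))"
    proof (rule prob_stay_le_expectation[OF t l r \<delta>])
      \<comment> \<open>The midpoint of \<open>x + y\<close> and \<open>x - y\<close> is
        \<open>x\<close>. Two points of \<open>?A\<close> have their midpoint above
        \<open>r + \<delta>\<close>, two points of \<open>?B\<close> below
        \<open>l - \<delta>\<close>, and one point of each strictly between \<open>l\<close> and
        \<open>r\<close>.\<close>
      show "0 \<le> ?f (x + y) + ?f (x - y)" if "x \<in> {l - \<delta><..l} \<union> {r..<r + \<delta>}" for x y
        using that l r \<delta> by (auto simp: indicator_def)
    qed (use l r \<delta> in \<open>auto simp: indicator_def\<close>)
    also have "\<dots> = ?U \<delta>"
      using t l r by (subst expectation_two_indicators) (auto simp: marginal_intervals)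
    finally show ?thesis .
  qed
  then have "eventually (\<lambda>\<delta>. prob (stay t l r) \<le> ?U \<delta>) (at_right 0)"
    by (auto simp: eventually_at_filter)
  moreover have "(?U \<longlongrightarrow> ?U 0) (at_right 0)"
    by (intro tendsto_intros isCont_tendsto_compose[OF isCont_marginal_cdf[OF t]])
  ultimately have "prob (stay t l r) \<le> ?U 0"
    by (intro tendsto_lowerbound[of ?U]) auto
  then show ?thesis by simp
qed

text \<open>Extending the image interval below \<open>l\<close> to a half-line reverses the sign
  condition. The cost, \<open>2 * marginal_cdf t (2 * l - r)\<close>, is the exact gap to the upper
  bound.\<close>

lemma prob_stay_lower_bound:
  assumes t: "0 < t" and l: "l < 0" and r: "0 < r"
  shows "1 - 2 * marginal_cdf t l - 2 * (marginal_cdf t (2 * r - l) - marginal_cdf t r)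
    \<le> prob (stay t l r)"
proof -
  let ?C = "marginal_cdf t"
  let ?L = "\<lambda>\<delta>. 1 - 2 * ?C (l + \<delta>) - 2 * (?C (2 * r - l - \<delta>) - ?C (r - \<delta>))"
  have "?L \<delta> \<le> prob (stay t l r)" if \<delta>: "0 < \<delta>" "\<delta> < min (- l) r" for \<delta>
  proof -
    \<comment> \<open>Here the whole half-line below \<open>l\<close> is negative, so only the reflection in \<open>r\<close> is exact.\<close>
    let ?A = "{..l + \<delta>}" and ?B = "{r - \<delta>..2 * r - l - \<delta>}"
    let ?f = "\<lambda>x. 1 - 2 * indicator ?A x - 2 * indicator ?B x :: real"
    have "?L \<delta> = expectation (\<lambda>\<omega>. ?f (X t \<omega>))"
      using t l r by (subst expectation_two_indicators) (auto simp: marginal_intervals)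
    also have "\<dots> \<le> prob (stay t l r)"
    proof (rule expectation_le_prob_stay[where \<delta> = \<delta>])
      \<comment> \<open>For \<open>x\<close> near \<open>l\<close> the smaller of the two points
        lies in \<open>?A\<close>. For \<open>x\<close> near \<open>r\<close> the larger one lies in
        \<open>?B\<close> or exceeds \<open>2 * r - l - \<delta>\<close>, and then the smaller one,
        since \<open>x < r\<close>, is below \<open>l + \<delta>\<close>.\<close>
      show "?f (x + y) + ?f (x - y) \<le> 0" if "x \<in> {l<..l + \<delta>} \<union> {r - \<delta>..<r}" for x y
        using that l r \<delta> by (auto simp: indicator_def)
    qed (use t l r \<delta> in \<open>auto simp: indicator_def\<close>)
    finally show ?thesis .
  qed
  moreover have "eventually (\<lambda>\<delta>. \<delta> < min (- l) r) (at_right (0::real))"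
    using l r by (intro order_tendstoD(2)[OF tendsto_ident_at]) auto
  moreover have "eventually (\<lambda>\<delta>. 0 < \<delta>) (at_right (0::real))"
    by (simp add: eventually_at_filter)
  ultimately have "eventually (\<lambda>\<delta>. ?L \<delta> \<le> prob (stay t l r)) (at_right 0)"
    by (auto elim: eventually_elim2)
  moreover have "(?L \<longlongrightarrow> ?L 0) (at_right 0)"
    by (intro tendsto_intros isCont_tendsto_compose[OF isCont_marginal_cdf[OF t]])
  ultimately have "?L 0 \<le> prob (stay t l r)"
    by (intro tendsto_upperbound[of ?L]) auto
  then show ?thesis by simp
qed

section \<open>Symmetry of the law and its Gaussian integrals\<close>

lemma marginal_cdf_minus:
  assumes "0 < t"
  shows "marginal_cdf t (- x) = 1 - marginal_cdf t x"
proof -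
  have [measurable]: "X t \<in> borel_measurable M"
    using random_variable_at assms by simp
  have "distr M borel (\<lambda>\<omega>. - X t \<omega>) = distr M borel (\<lambda>\<omega>. - (X t \<omega> - X 0 \<omega>))"
    by (rule distr_cong) (auto simp: start_at_zero)
  also have "\<dots> = distr M borel (\<lambda>\<omega>. X t \<omega> - X 0 \<omega>)"
    using assms by (intro increment_symmetric) auto
  also have "\<dots> = distr M borel (X t)"
    by (rule distr_cong) (auto simp: start_at_zero)
  finally have sym: "distr M borel (\<lambda>\<omega>. - X t \<omega>) = distr M borel (X t)" .
  have "marginal_cdf t (- x) = prob (X t -` {..- x} \<inter> space M)"
    by (simp flip: marginal_intervals(1)[OF assms] add: measure_distr)
  also have "X t -` {..- x} \<inter> space M = (\<lambda>\<omega>. - X t \<omega>) -` {x..} \<inter> space M"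
    by auto
  also have "prob \<dots> = measure (distr M borel (\<lambda>\<omega>. - X t \<omega>)) {x..}"
    by (simp add: measure_distr)
  finally show ?thesis
    by (simp add: sym marginal_intervals(2)[OF assms])
qed

text \<open>\<open>X t / sqrt t\<close> is standard normal, and \<open>sqrt (2 / pi)\<close> is
  twice the normalising constant \<open>1 / sqrt (2 * pi)\<close>.\<close>

lemma std_normal_set_integral:
  assumes t: "0 < t" and A[measurable]: "A \<in> sets borel"
  shows "sqrt (2 / pi) * (LBINT u:A. exp (- u\<^sup>2 / 2)) = 2 * prob {\<omega> \<in> space M. X t \<omega> / sqrt t \<in> A}"
proof -
  have d: "distributed M lborel (\<lambda>\<omega>. (X t \<omega> - 0) / sqrt t) std_normal_density"
    using marginal_density[OF t] t by (subst normal_standard_normal_convert[symmetric]) auto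
  have [measurable]: "X t \<in> borel_measurable M"
    using random_variable_at t by simp
  have "prob {\<omega> \<in> space M. X t \<omega> / sqrt t \<in> A} = expectation (indicator {\<omega> \<in> space M. X t \<omega> / sqrt t \<in> A})"
    by simp
  also have "\<dots> = expectation (\<lambda>\<omega>. indicator A ((X t \<omega> - 0) / sqrt t))"
    by (intro Bochner_Integration.integral_cong) (auto simp: indicator_def)
  also have "\<dots> = (LBINT u:A. std_normal_density u)"
    using distributed_integral[OF d, of "indicator A"] unfolding set_lebesgue_integral_def
    by (simp add: mult.commute)
  also have "\<dots> = (LBINT u:A. 1 / sqrt (2 * pi) * exp (- u\<^sup>2 / 2))"
    by (simp add: std_normal_density_def)
  also have "\<dots> = 1 / sqrt (2 * pi) * (LBINT u:A. exp (- u\<^sup>2 / 2))"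
    by (rule set_integral_mult_right)
  finally have "2 * prob {\<omega> \<in> space M. X t \<omega> / sqrt t \<in> A} = 2 / sqrt (2 * pi) * (LBINT u:A. exp (- u\<^sup>2 / 2))"
    by simp
  moreover have "2 / sqrt (2 * pi) = sqrt (2 / pi)"
    by (simp add: real_sqrt_mult real_sqrt_divide field_simps)
  ultimately show ?thesis by simp
qed

lemma gaussian_tail_integral:
  assumes "0 < t"
  shows "sqrt (2 / pi) * (LBINT u:{x / sqrt t..}. exp (- u\<^sup>2 / 2)) = 2 * (1 - marginal_cdf t x)"
proof -
  have [measurable]: "X t \<in> borel_measurable M"
    using random_variable_at assms by simp
  have "{\<omega> \<in> space M. X t \<omega> / sqrt t \<in> {x / sqrt t..}} = X t -` {x..} \<inter> space M"
    using assms by (auto simp: divide_right_mono divide_le_cancel)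
  then show ?thesis
    using std_normal_set_integral[OF assms, of "{x / sqrt t..}"] marginal_intervals(2)[OF assms, of x]
    by (simp add: measure_distr)
qed

lemma gaussian_interval_integral:
  assumes "0 < t" "x \<le> y"
  shows "sqrt (2 / pi) * (LBINT u:{x / sqrt t..y / sqrt t}. exp (- u\<^sup>2 / 2))
    = 2 * (marginal_cdf t y - marginal_cdf t x)"
proof -
  have [measurable]: "X t \<in> borel_measurable M"
    using random_variable_at assms by simp
  have "{\<omega> \<in> space M. X t \<omega> / sqrt t \<in> {x / sqrt t..y / sqrt t}} = X t -` {x..y} \<inter> space M"
    using assms by (auto simp: divide_right_mono divide_le_cancel)
  then show ?thesis
    using std_normal_set_integral[OF assms(1), of "{x / sqrt t..y / sqrt t}"] marginal_intervals(3)[OF assms]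
    by (simp add: measure_distr)
qed

end

section \<open>Elementary Gaussian estimates\<close>

lemma set_integrable_gaussian:
  assumes "A \<in> sets borel"
  shows "set_integrable lborel A (\<lambda>u. exp (- u\<^sup>2 / 2 :: real))"
proof -
  have "integrable lborel (\<lambda>u. sqrt (2 * pi) * std_normal_density u)"
    by simp
  then have "integrable lborel (\<lambda>u. exp (- u\<^sup>2 / 2 :: real))"
    by (simp add: std_normal_density_def)
  then show ?thesis
    using assms unfolding set_integrable_def by (intro integrable_mult_indicator) auto
qed

text \<open>For \<open>u \<ge> x \<ge> 0\<close> one has
  \<open>u\<^sup>2 \<ge> x\<^sup>2 + (u - x)\<^sup>2\<close>, so the integrand is dominated by a
  multiple of the normal density centred at \<open>x\<close>, which has total mass 1.\<close>

lemma gaussian_tail_le: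
  assumes "0 \<le> x"
  shows "(LBINT u:{x..}. exp (- u\<^sup>2 / 2)) \<le> sqrt (2 * pi) * exp (- x\<^sup>2 / 2)"
proof -
  let ?g = "\<lambda>u. sqrt (2 * pi) * exp (- x\<^sup>2 / 2) * normal_density x 1 u"
  have "(LBINT u:{x..}. exp (- u\<^sup>2 / 2)) \<le> (LBINT u. ?g u)"
    unfolding set_lebesgue_integral_def
  proof (rule integral_mono)
    show "integrable lborel (\<lambda>u. indicat_real {x..} u *\<^sub>R exp (- u\<^sup>2 / 2))"
      using set_integrable_gaussian[of "{x..}"] by (simp add: set_integrable_def)
    fix u
    show "indicat_real {x..} u *\<^sub>R exp (- u\<^sup>2 / 2) \<le> ?g u"
    proof (cases "x \<le> u")
      case True
      then have "0 \<le> x * (u - x)"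
        using assms by simp
      then have "- u\<^sup>2 / 2 \<le> - x\<^sup>2 / 2 + - (u - x)\<^sup>2 / 2"
        by (simp add: power2_eq_square algebra_simps)
      then have "exp (- u\<^sup>2 / 2) \<le> exp (- x\<^sup>2 / 2) * exp (- (u - x)\<^sup>2 / 2)"
        by (simp flip: exp_add)
      then show ?thesis
        using True by (simp add: normal_density_def)
    qed simp
  qed simp
  also have "\<dots> = sqrt (2 * pi) * exp (- x\<^sup>2 / 2)"
    by simp
  finally show ?thesis .
qed

text \<open>On the nonnegative half-line the integrand decreases, so its minimum is at the right
  endpoint.\<close>

lemma gaussian_interval_ge:
  fixes u v :: real
  assumes "0 \<le> u" "u \<le> v"
  shows "(v - u) * exp (- v\<^sup>2 / 2) \<le> (LBINT x:{u..v}. exp (- x\<^sup>2 / 2))"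
proof -
  have "(LBINT x:{u..v}. exp (- v\<^sup>2 / 2)) \<le> (LBINT x:{u..v}. exp (- x\<^sup>2 / 2))"
  proof (rule set_integral_mono)
    show "set_integrable lborel {u..v} (\<lambda>x. exp (- v\<^sup>2 / 2))"
      unfolding set_integrable_def using assms
      by (intro integrable_scaleR_left integrable_real_indicator) auto
    show "exp (- v\<^sup>2 / 2) \<le> exp (- x\<^sup>2 / 2)" if "x \<in> {u..v}" for x
      using that assms by (auto intro!: power_mono)
  qed (rule set_integrable_gaussian, simp)
  then show ?thesis
    using assms by (simp add: set_integral_const)
qed

section \<open>The asymptotic formula\<close>

theorem proposition13p3:
  fixes M :: "'a measure" and X :: "real \<Rightarrow> 'a \<Rightarrow> real" and a t :: real
  assumes "standard_wiener_process M X"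
    and "a > 0" and "t > 0"
  shows "\<exists>\<epsilon> :: real \<Rightarrow> real. \<epsilon> \<in> o[at_top](\<lambda>_. 1) \<and>
    (\<forall>b>0. p2 M X t (- b) a =
        1 - sqrt (2 / pi) * (LBINT u:{a / sqrt t..}. exp (- u\<^sup>2 / 2))
          - sqrt (2 / pi) * (LBINT u:{b / sqrt t..(b + 2 * a) / sqrt t}. exp (- u\<^sup>2 / 2))
              * (1 + \<epsilon> b))"
proof -
  interpret standard_wiener_process M X
    by (rule assms(1))
  let ?T = "\<lambda>x. sqrt (2 / pi) * (LBINT u:{x / sqrt t..}. exp (- u\<^sup>2 / 2))"
  define D where "D b = sqrt (2 / pi) * (LBINT u:{b / sqrt t..(b + 2 * a) / sqrt t}. exp (- u\<^sup>2 / 2))" for b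
  \<comment> \<open>The quotient of the constant in the upper bound for
    \<open>?T (2 * b + a)\<close> by the constant in the lower bound for \<open>D b\<close>.\<close>
  define K where "K = sqrt (2 * pi) * sqrt t / (2 * a)"
  \<comment> \<open>The claimed identity solved for the error; the division is legitimate for
    \<open>b > 0\<close>, where \<open>D b > 0\<close>.\<close>
  define \<epsilon> where "\<epsilon> b = (1 - ?T a - p2 M X t (- b) a) / D b - 1" for b
  have D_ge: "sqrt (2 / pi) * (2 * a / sqrt t * exp (- (b + 2 * a)\<^sup>2 / (2 * t))) \<le> D b" if "0 < b" for b
  proof -
    have "((b + 2 * a) / sqrt t - b / sqrt t) * exp (- ((b + 2 * a) / sqrt t)\<^sup>2 / 2)
        \<le> (LBINT u:{b / sqrt t..(b + 2 * a) / sqrt t}. exp (- u\<^sup>2 / 2))"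
      using that assms by (intro gaussian_interval_ge) (auto simp: divide_right_mono)
    moreover have "(b + 2 * a) / sqrt t - b / sqrt t = 2 * a / sqrt t"
      by (simp flip: diff_divide_distrib)
    moreover have "- ((b + 2 * a) / sqrt t)\<^sup>2 / 2 = - (b + 2 * a)\<^sup>2 / (2 * t)"
      using assms by (simp add: power_divide)
    ultimately show ?thesis
      unfolding D_def by (intro mult_left_mono) (auto simp: mult.commute)
  qed
  have lower_pos: "0 < sqrt (2 / pi) * (2 * a / sqrt t * exp (- (b + 2 * a)\<^sup>2 / (2 * t)))" for b
    using assms by simp
  have D_pos: "0 < D b" if "0 < b" for b
    using D_ge[OF that] lower_pos[of b] by linarith
  \<comment> \<open>With \<open>l = - b\<close> and \<open>r = a\<close>, the lower image bound is
    exactly \<open>1 - ?T a - D b\<close>, which gives the sign; the upper one exceeds it by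
    \<open>?T (2 * b + a)\<close>.\<close>
  have bounds: "- (?T (2 * b + a)) \<le> \<epsilon> b * D b \<and> \<epsilon> b * D b \<le> 0" if b: "0 < b" for b
  proof -
    have p2: "p2 M X t (- b) a = prob (stay t (- b) a)"
      by (simp add: p2_def stay_def)
    have eq: "\<epsilon> b * D b = 1 - ?T a - D b - p2 M X t (- b) a"
      using D_pos[OF b] by (simp add: \<epsilon>_def field_simps)
    have D: "D b = 2 * (marginal_cdf t (b + 2 * a) - marginal_cdf t b)"
      unfolding D_def using assms by (intro gaussian_interval_integral) auto
    have args: "2 * a - - b = b + 2 * a" "2 * - b - a = - (2 * b + a)"
      by simp_all
    show ?thesis
      using prob_stay_upper_bound[of t "- b" a] prob_stay_lower_bound[of t "- b" a] assms b
      unfolding eq unfolding p2 D gaussian_tail_integral[OF \<open>0 < t\<close>] args marginal_cdf_minus[OF \<open>0 < t\<close>]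
      by simp
  qed
  have small: "norm (\<epsilon> b) \<le> K * exp (- (3 * b\<^sup>2 - 3 * a\<^sup>2) / (2 * t))" if b: "0 < b" for b
  proof -
    have "\<bar>\<epsilon> b\<bar> * D b = \<bar>\<epsilon> b * D b\<bar>"
      using D_pos[OF b] by (simp add: abs_mult)
    also have "\<dots> \<le> ?T (2 * b + a)"
      using bounds[OF b] by linarith
    also have "\<dots> \<le> sqrt (2 / pi) * (sqrt (2 * pi) * exp (- ((2 * b + a) / sqrt t)\<^sup>2 / 2))"
      using b assms by (intro mult_left_mono gaussian_tail_le) auto
    \<comment> \<open>The mixed terms cancel: \<open>(2 * b + a)\<^sup>2 - (b + 2 * a)\<^sup>2 = 3 *
      b\<^sup>2 - 3 * a\<^sup>2\<close>. This surplus in the exponent makes the error small relative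
      to \<open>D b\<close>.\<close>
    also have "- ((2 * b + a) / sqrt t)\<^sup>2 / 2
        = - (b + 2 * a)\<^sup>2 / (2 * t) + - (3 * b\<^sup>2 - 3 * a\<^sup>2) / (2 * t)"
      using assms by (simp add: field_simps) (simp add: power2_eq_square algebra_simps)
    also have "sqrt (2 / pi) * (sqrt (2 * pi) * exp (- (b + 2 * a)\<^sup>2 / (2 * t) + - (3 * b\<^sup>2 - 3 * a\<^sup>2) / (2 * t)))
        = K * exp (- (3 * b\<^sup>2 - 3 * a\<^sup>2) / (2 * t))
          * (sqrt (2 / pi) * (2 * a / sqrt t * exp (- (b + 2 * a)\<^sup>2 / (2 * t))))"
      unfolding K_def exp_add using assms by simp
    also have "\<dots> \<le> K * exp (- (3 * b\<^sup>2 - 3 * a\<^sup>2) / (2 * t)) * D b"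
      using D_ge[OF b] assms by (intro mult_left_mono) (auto simp: K_def)
    finally show ?thesis
      using D_pos[OF b] by simp
  qed
  have "((\<lambda>b. K * exp (- (3 * b\<^sup>2 - 3 * a\<^sup>2) / (2 * t))) \<longlongrightarrow> 0) at_top"
    using assms(3) by real_asymp
  moreover have "eventually (\<lambda>b. norm (\<epsilon> b) \<le> K * exp (- (3 * b\<^sup>2 - 3 * a\<^sup>2) / (2 * t))) at_top"
    using eventually_gt_at_top[of 0] by eventually_elim (rule small)
  ultimately have "(\<epsilon> \<longlongrightarrow> 0) at_top"
    by (rule Lim_null_comparison[rotated])
  then have "\<epsilon> \<in> o[at_top](\<lambda>_. 1)"
    by (intro smalloI_tendsto) auto
  moreover have "p2 M X t (- b) a = 1 - ?T a - D b * (1 + \<epsilon> b)" if "0 < b" for b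
    using D_pos[OF that] by (simp add: \<epsilon>_def)
  ultimately show ?thesis
    unfolding D_def by blast
qed

end
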